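(* For integers $q\ge0$ and $m\ge1$, we have $$\sum_{\substack{a+b=q\\ a,b\ge0}}\zeta_{\mathcal{A}}^{(2)}(\{2\}^{a},m,\{2\}^{b})=(-1)^q\,\zeta_{\mathcal{A}}^{(2)}(m+2q)\quad\text{in }\mathcal{A}.$$
   Context: Let $\mathcal{P}$ be the set of prime numbers and $\mathcal{A}=\prod_{p\in\mathcal{P}}\mathbb{Z}/p\mathbb{Z}\big/\bigoplus_{p\in\mathcal{P}}\mathbb{Z}/p\mathbb{Z}$, which is a $\mathbb{Q}$-algebra. For a finite sequence of positive integers $(k_1,\ldots,k_r)$, the level-two finite multiple zeta value is $$\zeta_{\mathcal{A}}^{(2)}(k_1,\ldots,k_r)=\left(\sum_{0<n_1<\cdots<n_r<p/2}\frac{1}{n_1^{k_1}\cdots n_r^{k_r}}\bmod p\right)_{p}\in\mathcal{A}.$$ $\{2\}^a$ denotes the sequence consisting of $2$ repeated $a$ times. *)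

theory Defs
  imports "HOL-Number_Theory.Residues" "HOL-Algebra.QuotRing"
begin

text \<open>HOL-Algebra only has binary products of rings, hence the product of a family of rings here.
  Elements are extensional functions on the index set.\<close>

definition prod_ring :: "'i set \<Rightarrow> ('i \<Rightarrow> 'a ring) \<Rightarrow> ('i \<Rightarrow> 'a) ring" where
  "prod_ring I R =
    \<lparr>carrier = (\<Pi>\<^sub>E i\<in>I. carrier (R i)),
     monoid.mult = (\<lambda>x y. \<lambda>i\<in>I. x i \<otimes>\<^bsub>R i\<^esub> y i),
     one = (\<lambda>i\<in>I. \<one>\<^bsub>R i\<^esub>),
     ring.zero = (\<lambda>i\<in>I. \<zero>\<^bsub>R i\<^esub>),
     add = (\<lambda>x y. \<lambda>i\<in>I. x i \<oplus>\<^bsub>R i\<^esub> y i)\<rparr>"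

definition direct_sum :: "'i set \<Rightarrow> ('i \<Rightarrow> 'a ring) \<Rightarrow> ('i \<Rightarrow> 'a) set" where
  "direct_sum I R = {x \<in> carrier (prod_ring I R). finite {i \<in> I. x i \<noteq> \<zero>\<^bsub>R i\<^esub>}}"

abbreviation Fp :: "nat \<Rightarrow> int ring" where
  "Fp p \<equiv> residue_ring (int p)"

abbreviation primes :: "nat set" where
  "primes \<equiv> {p. prime p}"

definition ringA :: "(nat \<Rightarrow> int) set ring" where
  "ringA = prod_ring primes Fp Quot direct_sum primes Fp"

definition classA :: "(nat \<Rightarrow> int) \<Rightarrow> (nat \<Rightarrow> int) set" where
  "classA x = direct_sum primes Fp +>\<^bsub>prod_ring primes Fp\<^esub> (\<lambda>p\<in>primes. x p)"

text \<open>The tuples \<open>0 < n\<^sub>1 < \<dots> < n\<^sub>r < p/2\<close>, encoded as strictly increasing lists.\<close>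

definition half_tuples :: "nat \<Rightarrow> nat \<Rightarrow> nat list set" where
  "half_tuples p r =
    {ns. length ns = r \<and> sorted_wrt (<) ns \<and> (\<forall>n\<in>set ns. 0 < n \<and> real n < real p / 2)}"

text \<open>The truncated sum modulo \<open>p\<close>, computed in the field with \<open>p\<close> elements. Since \<open>0 < n < p\<close>,
  the integer \<open>n\<close> is its own representative in \<open>Fp p\<close>, and it is a unit there.\<close>

definition zeta2_mod :: "nat \<Rightarrow> nat list \<Rightarrow> int" where
  "zeta2_mod p ks =
    (\<Oplus>\<^bsub>Fp p\<^esub> ns\<in>half_tuples p (length ks).
       inv\<^bsub>Fp p\<^esub> (\<Otimes>\<^bsub>Fp p\<^esub> i\<in>{..<length ks}. int (ns ! i) [^]\<^bsub>Fp p\<^esub> (ks ! i)))"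

definition zetaA2 :: "nat list \<Rightarrow> (nat \<Rightarrow> int) set" where
  "zetaA2 ks = classA (\<lambda>p. zeta2_mod p ks)"


subsection \<open>Well-definedness\<close>

lemma prod_ring_cring:
  assumes "\<And>i. i \<in> I \<Longrightarrow> cring (R i)"
  shows "cring (prod_ring I R)"
proof -
  have r: "ring (R i)" if "i \<in> I" for i
    using assms[OF that] by (simp add: cring_def)
  have ab: "abelian_group (R i)" if "i \<in> I" for i
    using r[OF that] by (simp add: ring_def)
  have am: "abelian_monoid (R i)" if "i \<in> I" for i
    using ab[OF that] by (simp add: abelian_group_def)
  have cm: "comm_monoid (R i)" if "i \<in> I" for i
    using assms[OF that] by (simp add: cring_def)
  have mo: "monoid (R i)" if "i \<in> I" for i
    using cm[OF that] by (simp add: comm_monoid_def)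
  have mem: "x i \<in> carrier (R i)" if "x \<in> (\<Pi>\<^sub>E i\<in>I. carrier (R i))" "i \<in> I" for x i
    using that by auto
  have undef: "x i = undefined" if "x \<in> (\<Pi>\<^sub>E i\<in>I. carrier (R i))" "i \<notin> I" for x i
    using that by auto
  have ag: "abelian_group (prod_ring I R)"
  proof (rule abelian_groupI, goal_cases)
    case (6 x)
    have mem': "x i \<in> carrier (R i)" if "i \<in> I" for i
      using 6 that by (auto simp: prod_ring_def)
    define y where "y = (\<lambda>i\<in>I. \<ominus>\<^bsub>R i\<^esub> x i)"
    have "y \<in> carrier (prod_ring I R)"
      using mem' by (auto simp: y_def prod_ring_def intro!: abelian_group.a_inv_closed[OF ab])
    moreover have "y \<oplus>\<^bsub>prod_ring I R\<^esub> x = \<zero>\<^bsub>prod_ring I R\<^esub>"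
      using mem' by (auto simp: y_def prod_ring_def abelian_group.l_neg[OF ab]
          intro!: restrict_ext)
    ultimately show ?case by blast
  qed (auto simp: prod_ring_def mem abelian_monoid.a_closed[OF am]
      abelian_monoid.zero_closed[OF am] abelian_monoid.a_assoc[OF am]
      abelian_monoid.a_ac[OF am] abelian_monoid.l_zero[OF am]
      abelian_monoid.r_zero[OF am]
      simp: undef intro!: ext)
  have "comm_monoid (prod_ring I R)"
    by (rule comm_monoidI)
      (auto simp: prod_ring_def mem monoid.m_closed[OF mo] monoid.one_closed[OF mo]
        monoid.m_assoc[OF mo] comm_monoid.m_ac[OF cm] monoid.l_one[OF mo] monoid.r_one[OF mo]
        simp: undef intro!: ext)
  with ag show ?thesis
    by (rule cringI)
      (auto simp: prod_ring_def mem ring.ring_simprules(13)[OF r] intro!: restrict_ext)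
qed

lemma direct_sum_ideal:
  assumes "\<And>i. i \<in> I \<Longrightarrow> cring (R i)"
  shows "ideal (direct_sum I R) (prod_ring I R)"
proof -
  interpret P: cring "prod_ring I R"
    using assms by (rule prod_ring_cring)
  have r: "ring (R i)" if "i \<in> I" for i
    using assms[OF that] by (simp add: cring_def)
  have null: "y \<otimes>\<^bsub>R i\<^esub> \<zero>\<^bsub>R i\<^esub> = \<zero>\<^bsub>R i\<^esub>" if "i \<in> I" "y \<in> carrier (R i)" for i y
  proof -
    interpret ring "R i" using r[OF that(1)] .
    show ?thesis using that(2) by simp
  qed
  have lmult: "x \<otimes>\<^bsub>prod_ring I R\<^esub> a \<in> direct_sum I R"
    if a: "a \<in> direct_sum I R" and x: "x \<in> carrier (prod_ring I R)" for a x
  proof -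
    have mem: "x i \<in> carrier (R i)" if "i \<in> I" for i
      using x that by (auto simp: prod_ring_def)
    have "{i \<in> I. (x \<otimes>\<^bsub>prod_ring I R\<^esub> a) i \<noteq> \<zero>\<^bsub>R i\<^esub>} \<subseteq> {i \<in> I. a i \<noteq> \<zero>\<^bsub>R i\<^esub>}"
      by (auto simp: prod_ring_def null mem)
    then show ?thesis
      using a x P.m_closed by (auto simp: direct_sum_def intro: finite_subset)
  qed
  have sub: "direct_sum I R \<subseteq> carrier (prod_ring I R)"
    by (auto simp: direct_sum_def)
  have minus: "\<ominus>\<^bsub>prod_ring I R\<^esub> a \<in> direct_sum I R" if a: "a \<in> direct_sum I R" for a
  proof -
    have "\<ominus>\<^bsub>prod_ring I R\<^esub> \<one>\<^bsub>prod_ring I R\<^esub> \<otimes>\<^bsub>prod_ring I R\<^esub> a = \<ominus>\<^bsub>prod_ring I R\<^esub> a"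
      using a sub by (subst P.l_minus) auto
    then show ?thesis
      using lmult[OF a, of "\<ominus>\<^bsub>prod_ring I R\<^esub> \<one>\<^bsub>prod_ring I R\<^esub>"] by simp
  qed
  have add: "a \<oplus>\<^bsub>prod_ring I R\<^esub> b \<in> direct_sum I R"
    if a: "a \<in> direct_sum I R" and b: "b \<in> direct_sum I R" for a b
  proof -
    have "{i \<in> I. (a \<oplus>\<^bsub>prod_ring I R\<^esub> b) i \<noteq> \<zero>\<^bsub>R i\<^esub>}
        \<subseteq> {i \<in> I. a i \<noteq> \<zero>\<^bsub>R i\<^esub>} \<union> {i \<in> I. b i \<noteq> \<zero>\<^bsub>R i\<^esub>}"
      by (auto simp: prod_ring_def ring.ring_simprules(2)[OF r] ring.ring_simprules(8)[OF r])
    then show ?thesis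
      using a b P.a_closed by (auto simp: direct_sum_def intro: finite_subset)
  qed
  have zero: "\<zero>\<^bsub>prod_ring I R\<^esub> \<in> direct_sum I R"
    using P.zero_closed by (auto simp: direct_sum_def prod_ring_def)
  have "subgroup (direct_sum I R) (add_monoid (prod_ring I R))"
    by (rule group.subgroupI)
      (use sub zero minus[unfolded a_inv_def] add P.a_group in auto)
  moreover have "a \<otimes>\<^bsub>prod_ring I R\<^esub> x \<in> direct_sum I R"
    if "a \<in> direct_sum I R" "x \<in> carrier (prod_ring I R)" for a x
    using lmult[OF that] P.m_comm[of a x] that sub by auto
  ultimately show ?thesis
    using lmult by (intro idealI P.ring_axioms) auto
qed

lemma cring_Fp: "prime p \<Longrightarrow> cring (Fp p)"
  by (rule residues.cring) (simp add: residues_def prime_gt_Suc_0_nat)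

lemma cring_ringA: "cring ringA"
  unfolding ringA_def
  by (intro ideal.quotient_is_cring direct_sum_ideal prod_ring_cring) (auto intro: cring_Fp)

lemma finite_half_tuples: "finite (half_tuples p r)"
  by (rule finite_subset[OF _ finite_lists_length_eq[of "{..<p}" r]])
    (auto simp: half_tuples_def)

lemma zeta2_mod_closed:
  assumes "prime p"
  shows "zeta2_mod p ks \<in> carrier (Fp p)"
proof -
  interpret residues_prime p "Fp p"
    using assms by unfold_locales auto
  have unit: "int (ns ! i) \<in> Units (Fp p)"
    if "ns \<in> half_tuples p (length ks)" "i < length ks" for ns i
  proof -
    from that have "0 < ns ! i" "real (ns ! i) < real p / 2"
      by (auto simp: half_tuples_def)
    then show ?thesis
      by (auto simp: res_prime_units_eq)
  qed
  have "(\<Otimes>\<^bsub>Fp p\<^esub> i\<in>A. int (ns ! i) [^]\<^bsub>Fp p\<^esub> (ks ! i)) \<in> Units (Fp p)"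
    if "finite A" "A \<subseteq> {..<length ks}" "ns \<in> half_tuples p (length ks)" for ns A
    using that
  proof (induction A)
    case (insert i A)
    have u: "int (ns ! j) \<in> Units (Fp p)" if "j \<in> insert i A" for j
      using insert.prems that unit by auto
    then have "int (ns ! j) [^]\<^bsub>Fp p\<^esub> (ks ! j) \<in> Units (Fp p)" if "j \<in> insert i A" for j
      using that by (auto intro: Units_pow_closed)
    then show ?case
      using insert by (subst finprod_insert) (auto intro: Units_closed)
  qed auto
  then show ?thesis
    unfolding zeta2_mod_def by (intro finsum_closed) (auto simp: Pi_iff)
qed

lemma zetaA2_closed: "zetaA2 ks \<in> carrier ringA"
proof -
  interpret P: cring "prod_ring primes Fp"
    by (rule prod_ring_cring) (auto intro: cring_Fp)
  have "(\<lambda>p\<in>primes. zeta2_mod p ks) \<in> carrier (prod_ring primes Fp)"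
    by (auto simp: prod_ring_def zeta2_mod_closed)
  then show ?thesis
    by (auto simp: zetaA2_def classA_def ringA_def FactRing_def A_RCOSETS_defs a_r_coset_def)
qed

end

theory Submission
  imports Defs
begin

text \<open>Fix a prime \<open>p\<close>, write \<open>x\<^sub>n = n\<^sup>-\<^sup>2\<close> modulo \<open>p\<close> for \<open>0 < n < p/2\<close>, and let \<open>e\<^sub>k\<close> denote the
  \<open>k\<close>-th elementary symmetric sum. A term of the left-hand side is an increasing tuple with one marked
  position, carrying the exponent \<open>m\<close>, while all other positions carry the exponent \<open>2\<close>. Summing over
  the position of the mark forgets the order: what remains is a marked number \<open>n\<close> and a set of \<open>q\<close>
  further numbers, so that the left-hand side is \<open>\<Sum>\<^sub>n n\<^sup>-\<^sup>m e\<^sub>q(all x except x\<^sub>n)\<close>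
  (\<open>sum_sorted_lists_marked_position\<close>).

  The full symmetric sums \<open>e\<^sub>k\<close> with \<open>1 \<le> k \<le> q\<close> vanish modulo \<open>p\<close> as soon as \<open>p > 4\<^sup>q\<close>
  (\<open>esym_half_cong_0\<close>): up to sign, doubling permutes the numbers below \<open>p/2\<close>, so multiplication
  by \<open>4\<close> permutes the \<open>x\<^sub>n\<close>, whence \<open>4\<^sup>k e\<^sub>k = e\<^sub>k\<close>, and \<open>p\<close> does not divide \<open>4\<^sup>k - 1\<close>.
  The recursion \<open>e\<^sub>k(all) = e\<^sub>k(all except x\<^sub>n) + x\<^sub>n e\<^sub>k\<^sub>-\<^sub>1(all except x\<^sub>n)\<close> then gives
  \<open>e\<^sub>q(all except x\<^sub>n) = (- x\<^sub>n)\<^sup>q\<close> (\<open>esym_half_delete_cong\<close>), and the sum becomes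
  \<open>(-1)\<^sup>q \<Sum>\<^sub>n n\<^sup>-\<^sup>m\<^sup>-\<^sup>2\<^sup>q\<close>. The finitely many primes \<open>p \<le> 4\<^sup>q\<close> are invisible in the ring
  \<open>\<A>\<close>.

  All computations are done with integers and congruences: \<open>reduceA\<close> is the ring homomorphism from
  integer sequences to \<open>\<A>\<close>, and \<open>zeta2_mod_eq\<close> lifts the truncated sums to integers.\<close>

section \<open>Elementary symmetric sums\<close>

definition esym :: "nat \<Rightarrow> ('i \<Rightarrow> 'a::comm_ring_1) \<Rightarrow> 'i set \<Rightarrow> 'a" where
  "esym k x A = (\<Sum>S | S \<subseteq> A \<and> card S = k. prod x S)"

lemma esym_0 [simp]: "finite A \<Longrightarrow> esym 0 x A = 1"
proof -
  assume "finite A"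
  then have "{S. S \<subseteq> A \<and> card S = 0} = {{}}"
    by (auto dest: finite_subset)
  then show ?thesis
    by (simp add: esym_def)
qed

text \<open>A set of size \<open>k + 1\<close> either avoids \<open>n\<close> or is a set of size \<open>k\<close> avoiding \<open>n\<close>, with \<open>n\<close>
  inserted.\<close>

lemma esym_Suc_delete:
  assumes "finite A" "n \<in> A"
  shows "esym (Suc k) x A = esym (Suc k) x (A - {n}) + x n * esym k x (A - {n})"
proof -
  let ?B = "{S. S \<subseteq> A - {n} \<and> card S = k}"
  have split: "{S. S \<subseteq> A \<and> card S = Suc k} =
      {S. S \<subseteq> A - {n} \<and> card S = Suc k} \<union> insert n ` ?B" (is "?L = ?M \<union> _")
  proof (intro equalityI subsetI)
    fix S assume S: "S \<in> ?L"
    show "S \<in> ?M \<union> insert n ` ?B"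
    proof (cases "n \<in> S")
      case True
      then have "S = insert n (S - {n})" "S - {n} \<in> ?B"
        using S by auto
      then show ?thesis by blast
    qed (use S in auto)
  next
    fix S assume "S \<in> ?M \<union> insert n ` ?B"
    moreover have "card (insert n T) = Suc k" if "T \<in> ?B" for T
      using that assms(1) by (subst card_insert_disjoint) (auto intro: finite_subset[of _ A])
    ultimately show "S \<in> ?L"
      using assms(2) by auto
  qed
  have inj: "inj_on (insert n) ?B"
    by (rule inj_onI) blast
  have "esym (Suc k) x A = sum (prod x) ?M + sum (prod x) (insert n ` ?B)"
    unfolding esym_def split using assms(1) by (intro sum.union_disjoint) auto
  also have "sum (prod x) (insert n ` ?B) = (\<Sum>S\<in>?B. x n * prod x S)"
    unfolding sum.reindex[OF inj]
  proof (intro sum.cong refl)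
    fix S assume "S \<in> ?B"
    then have "finite S" "n \<notin> S"
      using assms(1) by (auto intro: finite_subset[of _ A])
    then show "(prod x \<circ> insert n) S = x n * prod x S" by simp
  qed
  finally show ?thesis
    by (simp add: esym_def sum_distrib_left)
qed

text \<open>A set of size \<open>q + 1\<close> with a marked element is the same as an element together with a set of
  size \<open>q\<close> that avoids it.\<close>

lemma sum_subsets_marked_element:
  fixes x y :: "'i \<Rightarrow> 'a::comm_ring_1"
  assumes "finite A"
  shows "(\<Sum>T | T \<subseteq> A \<and> card T = Suc q. \<Sum>n\<in>T. y n * prod x (T - {n}))
       = (\<Sum>n\<in>A. y n * esym q x (A - {n}))"
proof -
  let ?P = "SIGMA T:{T. T \<subseteq> A \<and> card T = Suc q}. T"
  let ?Q = "SIGMA n:A. {S. S \<subseteq> A - {n} \<and> card S = q}"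
  have fin: "finite T" if "T \<subseteq> A" for T
    using that assms by (rule finite_subset)
  have card_ins: "card (insert n S) = Suc (card S)" if "S \<subseteq> A - {n}" for n S
    using that fin[of S] by (subst card_insert_disjoint) auto
  have "(\<Sum>T | T \<subseteq> A \<and> card T = Suc q. \<Sum>n\<in>T. y n * prod x (T - {n}))
      = (\<Sum>(T, n)\<in>?P. y n * prod x (T - {n}))"
    using assms fin by (intro sum.Sigma) auto
  also have "\<dots> = (\<Sum>(n, S)\<in>?Q. y n * prod x S)"
    by (rule sum.reindex_bij_witness[of _ "\<lambda>(n, S). (insert n S, n)" "\<lambda>(T, n). (n, T - {n})"])
      (auto simp: card_ins insert_absorb)
  also have "\<dots> = (\<Sum>n\<in>A. \<Sum>S | S \<subseteq> A - {n} \<and> card S = q. y n * prod x S)"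
    using assms by (intro sum.Sigma[symmetric]) auto
  finally show ?thesis
    by (simp add: esym_def sum_distrib_left)
qed

lemma bij_betw_set_strict_sorted:
  fixes A :: "'a::linorder set"
  assumes "finite A"
  shows "bij_betw set {ns. length ns = r \<and> sorted_wrt (<) ns \<and> set ns \<subseteq> A}
           {S. S \<subseteq> A \<and> card S = r}"
proof (rule bij_betwI[where g = sorted_list_of_set])
  show "set \<in> {ns. length ns = r \<and> sorted_wrt (<) ns \<and> set ns \<subseteq> A} \<rightarrow> {S. S \<subseteq> A \<and> card S = r}"
    by (auto simp: strict_sorted_iff distinct_card)
  show "sorted_list_of_set \<in> {S. S \<subseteq> A \<and> card S = r} \<rightarrow>
      {ns. length ns = r \<and> sorted_wrt (<) ns \<and> set ns \<subseteq> A}"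
    using assms by (auto simp: finite_subset)
  show "sorted_list_of_set (set ns) = ns"
    if "ns \<in> {ns. length ns = r \<and> sorted_wrt (<) ns \<and> set ns \<subseteq> A}" for ns
    using that by (auto simp: strict_sorted_iff intro: sorted_list_of_set.idem_if_sorted_distinct)
  show "set (sorted_list_of_set S) = S" if "S \<in> {S. S \<subseteq> A \<and> card S = r}" for S
    using that assms by (auto simp: finite_subset)
qed

text \<open>The form in which the sums over \<open>({2}\<^sup>a, m, {2}\<^sup>b)\<close> appear, with \<open>y n = n\<^sup>-\<^sup>m\<close> and \<open>x n = n\<^sup>-\<^sup>2\<close>.
  An increasing list is determined by its set of entries, and its positions correspond to these
  entries; a marked position therefore becomes a marked element.\<close>

lemma sum_sorted_lists_marked_position:
  fixes x y :: "'i::linorder \<Rightarrow> 'a::comm_ring_1"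
  assumes "finite A"
  shows "(\<Sum>ns | length ns = Suc q \<and> sorted_wrt (<) ns \<and> set ns \<subseteq> A.
            \<Sum>a\<le>q. y (ns ! a) * (\<Prod>i\<in>{..q} - {a}. x (ns ! i)))
       = (\<Sum>n\<in>A. y n * esym q x (A - {n}))" (is "sum ?f ?L = _")
proof -
  have "sum ?f ?L = (\<Sum>ns\<in>?L. (\<lambda>T. \<Sum>n\<in>T. y n * prod x (T - {n})) (set ns))"
  proof (intro sum.cong refl)
    fix ns assume ns: "ns \<in> ?L"
    then have bij: "bij_betw ((!) ns) {..q} (set ns)"
      by (intro bij_betw_nth) (auto simp: strict_sorted_iff)
    have "(\<Prod>i\<in>{..q} - {a}. x (ns ! i)) = prod x (set ns - {ns ! a})" if "a \<le> q" for a
    proof -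
      have "bij_betw ((!) ns) ({..q} - {a}) (set ns - {ns ! a})"
        using that ns by (intro bij_betw_DiffI bij) auto
      then show ?thesis
        by (rule prod.reindex_bij_betw)
    qed
    then show "?f ns = (\<Sum>n\<in>set ns. y n * prod x (set ns - {n}))"
      by (simp flip: sum.reindex_bij_betw[OF bij])
  qed
  also have "\<dots> = (\<Sum>T | T \<subseteq> A \<and> card T = Suc q. \<Sum>n\<in>T. y n * prod x (T - {n}))"
    by (rule sum.reindex_bij_betw[OF bij_betw_set_strict_sorted[OF assms]])
  finally show ?thesis
    by (simp add: sum_subsets_marked_element[OF assms])
qed

section \<open>Reciprocal squares modulo a prime\<close>

definition half :: "nat \<Rightarrow> nat set" where
  "half p = {n. 0 < n \<and> 2 * n < p}"

lemma finite_half [simp]: "finite (half p)"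
  by (rule finite_subset[of _ "{..<p}"]) (auto simp: half_def)

lemma half_tuples_eq:
  "half_tuples p r = {ns. length ns = r \<and> sorted_wrt (<) ns \<and> set ns \<subseteq> half p}"
proof -
  have "real n < real p / 2 \<longleftrightarrow> 2 * n < p" for n
    by linarith
  then show ?thesis
    unfolding half_tuples_def half_def by auto
qed

text \<open>The map sends \<open>n\<close> to the representative of \<open>2 n\<close> or \<open>- 2 n\<close> that lies below \<open>p/2\<close>. It is
  injective because \<open>2 n = p - 2 n'\<close> is impossible for odd \<open>p\<close>.\<close>

lemma doubling_permutes_half:
  assumes "odd p"
  shows "bij_betw (\<lambda>n. if 4 * n < p then 2 * n else p - 2 * n) (half p) (half p)"
    (is "bij_betw ?\<phi> _ _")
proof -
  have "?\<phi> n \<in> half p" if "n \<in> half p" for n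
  proof -
    have "p \<noteq> 4 * n" using assms by auto
    then show ?thesis using that by (auto simp: half_def)
  qed
  moreover have "inj_on ?\<phi> (half p)"
  proof (rule inj_onI)
    fix n n' assume n: "n \<in> half p" "n' \<in> half p" "?\<phi> n = ?\<phi> n'"
    have "p \<noteq> 2 * n + 2 * n'" using assms by auto
    then show "n = n'" using n by (auto simp: half_def split: if_splits)
  qed
  ultimately show ?thesis
    unfolding bij_betw_def by (intro conjI endo_inj_surj finite_half image_subsetI)
qed

text \<open>The reciprocals are integer representatives, so that symmetric sums of them are formed in the
  integers and only compared modulo \<open>p\<close>.\<close>

locale half_reciprocals =
  fixes p :: nat and v :: "nat \<Rightarrow> int"
  assumes prime: "prime p"
    and recip: "n \<in> half p \<Longrightarrow> [int n * v n = 1] (mod int p)"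
begin

abbreviation inv_sq :: "nat \<Rightarrow> int" where
  "inv_sq n \<equiv> (v n)\<^sup>2"

lemma inv_sq_recip:
  assumes "n \<in> half p"
  shows "[(int n)\<^sup>2 * inv_sq n = 1] (mod int p)"
  using cong_pow[OF recip[OF assms], of 2] by (simp add: power_mult_distrib)

text \<open>The permutation \<open>\<phi>\<close> satisfies \<open>\<phi> n = \<plusminus> 2 n\<close>, so that \<open>4 x\<^bsub>\<phi> n\<^esub> = x\<^sub>n\<close> for the reciprocal
  squares \<open>x\<^sub>n\<close>. Reindexing the symmetric sum by \<open>\<phi>\<close> and distributing one factor \<open>4\<close> to each of the
  \<open>k\<close> elements of a subset reproduces the sum.\<close>

lemma four_esym_cong:
  assumes "odd p"
  shows "[4 ^ k * esym k inv_sq (half p) = esym k inv_sq (half p)] (mod int p)"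
proof -
  define \<phi> where "\<phi> n = (if 4 * n < p then 2 * n else p - 2 * n)" for n
  have bij: "bij_betw \<phi> (half p) (half p)"
    using doubling_permutes_half[OF assms] by (simp add: \<phi>_def[abs_def])
  have sq: "[(int (\<phi> n))\<^sup>2 = 4 * (int n)\<^sup>2] (mod int p)" if "n \<in> half p" for n
  proof (cases "4 * n < p")
    case False
    have "(int p - 2 * int n)\<^sup>2 - 4 * (int n)\<^sup>2 = int p * (int p - 4 * int n)"
      by (simp add: power2_eq_square algebra_simps)
    then show ?thesis
      using that False by (auto simp: \<phi>_def half_def cong_iff_dvd_diff of_nat_diff)
  qed (simp add: \<phi>_def power_mult_distrib)
  have four: "[4 * inv_sq (\<phi> n) = inv_sq n] (mod int p)" if n: "n \<in> half p" for n
  proof -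
    have \<phi>n: "\<phi> n \<in> half p"
      using bij n by (auto simp: bij_betw_def)
    \<comment> \<open>Insert \<open>1 = n\<^sup>2 x\<^sub>n\<close>, trade \<open>4 n\<^sup>2\<close> for \<open>(\<phi> n)\<^sup>2\<close>, and cancel that against its reciprocal.\<close>
    have "[4 * inv_sq (\<phi> n) * 1 = 4 * inv_sq (\<phi> n) * ((int n)\<^sup>2 * inv_sq n)] (mod int p)"
      using inv_sq_recip[OF n] by (intro cong_mult cong_refl) (rule cong_sym)
    also have "4 * inv_sq (\<phi> n) * ((int n)\<^sup>2 * inv_sq n) = (4 * (int n)\<^sup>2) * (inv_sq (\<phi> n) * inv_sq n)"
      by simp
    also have "[\<dots> = (int (\<phi> n))\<^sup>2 * (inv_sq (\<phi> n) * inv_sq n)] (mod int p)"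
      using sq[OF n] by (intro cong_mult cong_refl) (rule cong_sym)
    also have "(int (\<phi> n))\<^sup>2 * (inv_sq (\<phi> n) * inv_sq n) = (int (\<phi> n))\<^sup>2 * inv_sq (\<phi> n) * inv_sq n"
      by simp
    also have "[\<dots> = 1 * inv_sq n] (mod int p)"
      by (intro cong_mult cong_refl inv_sq_recip \<phi>n)
    finally show ?thesis by simp
  qed
  have bij': "bij_betw ((`) \<phi>) {S. S \<subseteq> half p \<and> card S = k} {S. S \<subseteq> half p \<and> card S = k}"
  proof -
    have "card (\<phi> ` S) = card S" if "S \<subseteq> half p" for S
      using that bij by (auto simp: bij_betw_def intro: card_image inj_on_subset)
    then have "bij_betw ((`) \<phi>) {S \<in> Pow (half p). card S = k} {S \<in> Pow (half p). card S = k}"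
      by (intro bij_betw_Collect bij_betw_Pow bij) auto
    then show ?thesis by simp
  qed
  have "4 ^ k * esym k inv_sq (half p) = (\<Sum>S | S \<subseteq> half p \<and> card S = k. 4 ^ k * prod inv_sq (\<phi> ` S))"
    by (simp add: esym_def sum_distrib_left sum.reindex_bij_betw[OF bij', of "prod inv_sq", symmetric])
  also have "\<dots> = (\<Sum>S | S \<subseteq> half p \<and> card S = k. \<Prod>n\<in>S. 4 * inv_sq (\<phi> n))"
  proof (intro sum.cong refl)
    fix S assume S: "S \<in> {S. S \<subseteq> half p \<and> card S = k}"
    then have "inj_on \<phi> S"
      using bij by (auto simp: bij_betw_def intro: inj_on_subset)
    then show "4 ^ k * prod inv_sq (\<phi> ` S) = (\<Prod>n\<in>S. 4 * inv_sq (\<phi> n))"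
      using S by (simp add: prod.reindex prod.distrib)
  qed
  also have "[\<dots> = esym k inv_sq (half p)] (mod int p)"
    unfolding esym_def using four by (intro cong_sum cong_prod) auto
  finally show ?thesis .
qed

text \<open>The bound on \<open>p\<close> guarantees \<open>0 < 4\<^sup>k - 1 < p\<close>, hence \<open>4\<^sup>k - 1\<close> can be cancelled from
  \<open>(4\<^sup>k - 1) e\<^sub>k = 0\<close>.\<close>

lemma esym_half_cong_0:
  assumes "0 < k" "4 ^ k < p"
  shows "[esym k inv_sq (half p) = 0] (mod int p)"
proof -
  have "4 ^ 1 \<le> (4 ^ k :: nat)"
    using assms(1) by (intro power_increasing) auto
  then have p: "odd p"
    using assms(2) prime by (intro prime_odd_nat) auto
  have "int p dvd (4 ^ k - 1) * esym k inv_sq (half p)"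
    using four_esym_cong[OF p, of k] by (simp add: cong_iff_dvd_diff algebra_simps)
  moreover have "\<not> int p dvd 4 ^ k - 1"
  proof
    assume "int p dvd 4 ^ k - 1"
    moreover have "(4::int) ^ 1 \<le> 4 ^ k"
      using assms(1) by (intro power_increasing) auto
    ultimately have "int p \<le> 4 ^ k - 1"
      by (intro zdvd_imp_le) auto
    moreover have "int (4 ^ k) < int p"
      using assms(2) by (simp only: of_nat_less_iff)
    ultimately show False by simp
  qed
  ultimately show ?thesis
    using prime by (simp add: cong_0_iff prime_dvd_mult_iff)
qed

text \<open>Since the full sums vanish, the deletion recursion turns into multiplication by \<open>- x\<^sub>n\<close> at each
  step.\<close>

lemma esym_half_delete_cong:
  assumes "n \<in> half p" "4 ^ k < p"
  shows "[esym k inv_sq (half p - {n}) = (- inv_sq n) ^ k] (mod int p)"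
  using assms(2)
proof (induction k)
  case (Suc k)
  have "[esym (Suc k) inv_sq (half p) - inv_sq n * esym k inv_sq (half p - {n}) = 0 - inv_sq n * (- inv_sq n) ^ k] (mod int p)"
    using Suc esym_half_cong_0[OF _ Suc.prems]
    by (intro cong_diff cong_mult cong_refl) auto
  then show ?case
    by (simp add: esym_Suc_delete[OF finite_half assms(1)])
qed simp

end

section \<open>Integer lifts of the truncated zeta values\<close>

definition recip :: "nat \<Rightarrow> nat \<Rightarrow> int" where
  "recip p n = inv\<^bsub>Fp p\<^esub> (int n)"

definition zeta2_int :: "nat \<Rightarrow> nat list \<Rightarrow> int" where
  "zeta2_int p ks =
     (\<Sum>ns\<in>half_tuples p (length ks). \<Prod>i<length ks. recip p (ns ! i) ^ (ks ! i))"

lemma half_reciprocals_recip: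
  assumes "prime p"
  shows "half_reciprocals p (recip p)"
proof
  interpret residues_prime p "Fp p"
    using assms by unfold_locales auto
  fix n assume "n \<in> half p"
  then have "int n \<in> Units (Fp p)"
    by (auto simp: res_prime_units_eq half_def)
  then have "int n \<otimes>\<^bsub>Fp p\<^esub> recip p n = \<one>\<^bsub>Fp p\<^esub>"
    unfolding recip_def by (rule Units_r_inv)
  then show "[int n * recip p n = 1] (mod int p)"
    using prime_gt_1_nat[OF assms] by (simp add: res_mult_eq res_one_eq cong_def)
qed (rule assms)

lemma zeta2_mod_eq:
  assumes "prime p"
  shows "zeta2_mod p ks = zeta2_int p ks mod int p"
proof -
  interpret residues_prime p "Fp p"
    using assms by unfold_locales auto
  interpret half_reciprocals p "recip p"
    using assms by (rule half_reciprocals_recip)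
  have pow: "int n [^]\<^bsub>Fp p\<^esub> k = int n ^ k mod int p" if "n \<in> half p" for n k
    using that pow_cong[of "int n" k] by (simp add: half_def)
  let ?N = "\<lambda>ns. \<Prod>i<length ks. int (ns ! i) ^ (ks ! i)"
  let ?V = "\<lambda>ns. \<Prod>i<length ks. recip p (ns ! i) ^ (ks ! i)"
  have summand: "inv\<^bsub>Fp p\<^esub> (\<Otimes>\<^bsub>Fp p\<^esub> i\<in>{..<length ks}. int (ns ! i) [^]\<^bsub>Fp p\<^esub> (ks ! i))
      = ?V ns mod int p"
    if ns: "ns \<in> half_tuples p (length ks)" for ns
  proof -
    have mem: "ns ! i \<in> half p" if "i < length ks" for i
      using ns that by (auto simp: half_tuples_eq)
    have "(\<Otimes>\<^bsub>Fp p\<^esub> i\<in>{..<length ks}. int (ns ! i) [^]\<^bsub>Fp p\<^esub> (ks ! i))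
        = (\<Otimes>\<^bsub>Fp p\<^esub> i\<in>{..<length ks}. int (ns ! i) ^ (ks ! i) mod int p)"
      using mem by (intro finprod_cong') (auto simp: pow mod_in_carrier)
    also have "\<dots> = ?N ns mod int p"
      by (rule prod_cong) auto
    finally have N: "(\<Otimes>\<^bsub>Fp p\<^esub> i\<in>{..<length ks}. int (ns ! i) [^]\<^bsub>Fp p\<^esub> (ks ! i))
        = ?N ns mod int p" .
    have "[(\<Prod>i<length ks. (int (ns ! i) * recip p (ns ! i)) ^ (ks ! i))
         = (\<Prod>i<length ks. 1 ^ (ks ! i))] (mod int p)"
      using mem by (intro cong_prod cong_pow recip) auto
    then have "[?N ns * ?V ns = 1] (mod int p)"
      by (simp add: power_mult_distrib prod.distrib)
    then have "?N ns mod int p \<otimes>\<^bsub>Fp p\<^esub> (?V ns mod int p) = \<one>\<^bsub>Fp p\<^esub>"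
      using prime_gt_1_nat[OF assms] by (simp add: mult_cong res_one_eq cong_def)
    then show ?thesis
      unfolding N by (intro comm_inv_char mod_in_carrier)
  qed
  have "zeta2_mod p ks = (\<Oplus>\<^bsub>Fp p\<^esub> ns\<in>half_tuples p (length ks). ?V ns mod int p)"
    unfolding zeta2_mod_def using summand by (intro finsum_cong') (auto simp: mod_in_carrier)
  also have "\<dots> = zeta2_int p ks mod int p"
    unfolding zeta2_int_def by (rule sum_cong) (rule finite_half_tuples)
  finally show ?thesis .
qed

text \<open>This identity holds already between integers, for every \<open>p\<close>; congruences only enter when the
  symmetric sums are evaluated. For \<open>q = 0\<close> it describes the depth-one sums.\<close>

lemma sum_zeta2_int_one_among_twos:
  "(\<Sum>a\<le>q. zeta2_int p (replicate a 2 @ [m] @ replicate (q - a) 2))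
     = (\<Sum>n\<in>half p. recip p n ^ m * esym q (\<lambda>n. (recip p n)\<^sup>2) (half p - {n}))"
proof -
  let ?ks = "\<lambda>a. replicate a 2 @ [m] @ replicate (q - a) 2"
  have nth: "?ks a ! i = (if i = a then m else 2)" if "a \<le> q" "i \<le> q" for a i
    using that by (auto simp: nth_append nth_Cons split: nat.split)
  have "zeta2_int p (?ks a) = (\<Sum>ns\<in>half_tuples p (Suc q).
      recip p (ns ! a) ^ m * (\<Prod>i\<in>{..q} - {a}. (recip p (ns ! i))\<^sup>2))" if a: "a \<le> q" for a
  proof -
    have len: "length (?ks a) = Suc q"
      using a by simp
    have "(\<Prod>i<Suc q. recip p (ns ! i) ^ (?ks a ! i)) =
        recip p (ns ! a) ^ m * (\<Prod>i\<in>{..q} - {a}. (recip p (ns ! i))\<^sup>2)" for ns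
    proof -
      have "(\<Prod>i<Suc q. recip p (ns ! i) ^ (?ks a ! i)) =
          (\<Prod>i\<le>q. recip p (ns ! i) ^ (if i = a then m else 2))"
        using a by (intro prod.cong) (auto simp: nth simp del: append.simps)
      also have "\<dots> = recip p (ns ! a) ^ m *
          (\<Prod>i\<in>{..q} - {a}. recip p (ns ! i) ^ (if i = a then m else 2))"
        using a by (subst prod.remove[of _ a]) auto
      also have "(\<Prod>i\<in>{..q} - {a}. recip p (ns ! i) ^ (if i = a then m else 2)) =
          (\<Prod>i\<in>{..q} - {a}. (recip p (ns ! i))\<^sup>2)"
        by (intro prod.cong) auto
      finally show ?thesis .
    qed
    then show ?thesis
      unfolding zeta2_int_def len by simp
  qed
  then have "(\<Sum>a\<le>q. zeta2_int p (?ks a)) = (\<Sum>a\<le>q. \<Sum>ns\<in>half_tuples p (Suc q).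
      recip p (ns ! a) ^ m * (\<Prod>i\<in>{..q} - {a}. (recip p (ns ! i))\<^sup>2))"
    by (intro sum.cong) auto
  also have "\<dots> = (\<Sum>ns\<in>half_tuples p (Suc q). \<Sum>a\<le>q.
      recip p (ns ! a) ^ m * (\<Prod>i\<in>{..q} - {a}. (recip p (ns ! i))\<^sup>2))"
    by (rule sum.swap)
  finally show ?thesis
    unfolding half_tuples_eq
    using sum_sorted_lists_marked_position[OF finite_half, where y = "\<lambda>n. recip p n ^ m"
        and x = "\<lambda>n. (recip p n)\<^sup>2"] by simp
qed

lemma zeta2_int_single: "zeta2_int p [m] = (\<Sum>n\<in>half p. recip p n ^ m)"
  using sum_zeta2_int_one_among_twos[of p m 0] by simp

lemma sum_zeta2_int_cong:
  assumes "prime p" "4 ^ q < p"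
  shows "[(\<Sum>a\<le>q. zeta2_int p (replicate a 2 @ [m] @ replicate (q - a) 2))
     = (- 1) ^ q * zeta2_int p [m + 2 * q]] (mod int p)"
proof -
  interpret half_reciprocals p "recip p"
    using assms(1) by (rule half_reciprocals_recip)
  have "[(\<Sum>n\<in>half p. recip p n ^ m * esym q inv_sq (half p - {n}))
      = (\<Sum>n\<in>half p. recip p n ^ m * (- inv_sq n) ^ q)] (mod int p)"
    using assms(2) by (intro cong_sum cong_mult cong_refl esym_half_delete_cong)
  also have "(\<Sum>n\<in>half p. recip p n ^ m * (- inv_sq n) ^ q) =
      (- 1) ^ q * (\<Sum>n\<in>half p. recip p n ^ (m + 2 * q))"
    by (simp add: sum_distrib_left power_add power_minus[of "(_)\<^sup>2"] mult_ac flip: power_mult)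
  finally show ?thesis
    unfolding sum_zeta2_int_one_among_twos zeta2_int_single .
qed

section \<open>Integer sequences in the ring \<open>\<A>\<close>\<close>

definition reduceA :: "(nat \<Rightarrow> int) \<Rightarrow> (nat \<Rightarrow> int) set" where
  "reduceA f = classA (\<lambda>p. f p mod int p)"

abbreviation prodF :: "(nat \<Rightarrow> int) ring" where
  "prodF \<equiv> prod_ring primes Fp"

abbreviation residuesF :: "(nat \<Rightarrow> int) \<Rightarrow> nat \<Rightarrow> int" where
  "residuesF f \<equiv> \<lambda>p\<in>primes. f p mod int p"

lemma residuesF_closed: "residuesF f \<in> carrier prodF"
  by (auto simp: prod_ring_def residue_ring_def prime_gt_0_nat)

lemma reduceA_hom: "reduceA f = (+>\<^bsub>prodF\<^esub>) (direct_sum primes Fp) (residuesF f)"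
  unfolding reduceA_def classA_def by (rule arg_cong2[where f="(+>\<^bsub>prodF\<^esub>)"]) auto

text \<open>Reduction modulo each prime is a homomorphism to the product ring, and so is the projection
  to the quotient.\<close>

lemma
  shows reduceA_closed: "reduceA f \<in> carrier ringA"
    and reduceA_add: "reduceA f \<oplus>\<^bsub>ringA\<^esub> reduceA g = reduceA (\<lambda>p. f p + g p)"
    and reduceA_mult: "reduceA f \<otimes>\<^bsub>ringA\<^esub> reduceA g = reduceA (\<lambda>p. f p * g p)"
    and reduceA_one: "reduceA (\<lambda>_. 1) = \<one>\<^bsub>ringA\<^esub>"
    and reduceA_zero: "reduceA (\<lambda>_. 0) = \<zero>\<^bsub>ringA\<^esub>"
proof -
  interpret I: ideal "direct_sum primes Fp" prodF
    by (rule direct_sum_ideal) (auto intro: cring_Fp)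
  have hom: "(+>\<^bsub>prodF\<^esub>) (direct_sum primes Fp) \<in> ring_hom prodF ringA"
    unfolding ringA_def by (rule I.rcos_ring_hom)
  have "residuesF f \<oplus>\<^bsub>prodF\<^esub> residuesF g = residuesF (\<lambda>p. f p + g p)"
    by (auto simp: prod_ring_def residue_ring_def mod_simps)
  moreover have "residuesF f \<otimes>\<^bsub>prodF\<^esub> residuesF g = residuesF (\<lambda>p. f p * g p)"
    by (auto simp: prod_ring_def residue_ring_def mod_simps)
  moreover have "residuesF (\<lambda>_. 1) = \<one>\<^bsub>prodF\<^esub>"
    by (auto simp: prod_ring_def residue_ring_def intro!: restrict_ext mod_pos_pos_trivial
        dest: prime_gt_1_nat)
  moreover have "residuesF (\<lambda>_. 0) = \<zero>\<^bsub>prodF\<^esub>"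
    by (auto simp: prod_ring_def residue_ring_def)
  moreover have "ring ringA"
    using cring_ringA by (rule cring.axioms)
  ultimately show "reduceA f \<in> carrier ringA" "reduceA f \<oplus>\<^bsub>ringA\<^esub> reduceA g = reduceA (\<lambda>p. f p + g p)"
    "reduceA f \<otimes>\<^bsub>ringA\<^esub> reduceA g = reduceA (\<lambda>p. f p * g p)" "reduceA (\<lambda>_. 1) = \<one>\<^bsub>ringA\<^esub>"
    "reduceA (\<lambda>_. 0) = \<zero>\<^bsub>ringA\<^esub>"
    unfolding reduceA_hom
    using ring_hom_closed[OF hom residuesF_closed[of f]]
      ring_hom_add[OF hom residuesF_closed[of f] residuesF_closed[of g]]
      ring_hom_mult[OF hom residuesF_closed[of f] residuesF_closed[of g]] ring_hom_one[OF hom]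
      ring_hom_zero[OF hom I.ring_axioms]
    by (simp_all only:)
qed

text \<open>A sequence that vanishes modulo all primes beyond \<open>N\<close> has its residues in the direct sum,
  which is the zero of the quotient.\<close>

lemma reduceA_eqI:
  assumes "\<And>p. prime p \<Longrightarrow> N < p \<Longrightarrow> [f p = g p] (mod int p)"
  shows "reduceA f = reduceA g"
proof -
  interpret I: ideal "direct_sum primes Fp" prodF
    by (rule direct_sum_ideal) (auto intro: cring_Fp)
  interpret A: cring ringA by (rule cring_ringA)
  have "residuesF (\<lambda>p. f p - g p) \<in> direct_sum primes Fp"
    unfolding direct_sum_def
  proof (intro CollectI conjI residuesF_closed)
    have "(f p - g p) mod int p = 0" if "prime p" "N < p" for p
      using assms[OF that] by (simp add: cong_iff_dvd_diff)
    then have "{p \<in> primes. residuesF (\<lambda>p. f p - g p) p \<noteq> \<zero>\<^bsub>Fp p\<^esub>} \<subseteq> {..N}"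
      unfolding residue_ring_def by (auto simp flip: not_less)
    then show "finite {p \<in> primes. residuesF (\<lambda>p. f p - g p) p \<noteq> \<zero>\<^bsub>Fp p\<^esub>}"
      by (rule finite_subset) simp
  qed
  then have "reduceA (\<lambda>p. f p - g p) = \<zero>\<^bsub>ringA\<^esub>"
    by (simp add: reduceA_hom ringA_def FactRing_def I.a_rcos_const)
  then have "reduceA (\<lambda>p. f p - g p) \<oplus>\<^bsub>ringA\<^esub> reduceA g = reduceA g"
    by (simp add: reduceA_closed)
  then show ?thesis
    unfolding reduceA_add by simp
qed

lemma reduceA_sum:
  assumes "finite S"
  shows "(\<Oplus>\<^bsub>ringA\<^esub> i\<in>S. reduceA (f i)) = reduceA (\<lambda>p. \<Sum>i\<in>S. f i p)"
proof -
  interpret A: cring ringA by (rule cring_ringA)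
  show ?thesis
    using assms
    by induction (auto simp: A.finsum_insert reduceA_closed reduceA_add reduceA_zero)
qed

lemma reduceA_minus_one_power: "(\<ominus>\<^bsub>ringA\<^esub> \<one>\<^bsub>ringA\<^esub>) [^]\<^bsub>ringA\<^esub> (q::nat) = reduceA (\<lambda>_. (- 1) ^ q)"
proof -
  interpret A: cring ringA by (rule cring_ringA)
  have "reduceA (\<lambda>_. - 1) \<oplus>\<^bsub>ringA\<^esub> \<one>\<^bsub>ringA\<^esub> = \<zero>\<^bsub>ringA\<^esub>"
    unfolding reduceA_one[symmetric] reduceA_add by (simp add: reduceA_zero)
  then have "\<ominus>\<^bsub>ringA\<^esub> \<one>\<^bsub>ringA\<^esub> = reduceA (\<lambda>_. - 1)"
    by (intro A.minus_equality) (auto simp: reduceA_closed)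
  then show ?thesis
    by (induction q) (auto simp: reduceA_one reduceA_mult mult.commute)
qed

lemma zetaA2_eq: "zetaA2 ks = reduceA (\<lambda>p. zeta2_int p ks)"
  unfolding zetaA2_def reduceA_def classA_def
  by (rule arg_cong2[where f="(+>\<^bsub>prodF\<^esub>)"]) (auto simp: zeta2_mod_eq)

theorem proposition3p9:
  fixes q m :: nat
  assumes "m \<ge> 1"
  shows "(\<Oplus>\<^bsub>ringA\<^esub> ab\<in>{(a, b). a + b = q}.
           case ab of (a, b) \<Rightarrow> zetaA2 (replicate a 2 @ [m] @ replicate b 2))
       = (\<ominus>\<^bsub>ringA\<^esub> \<one>\<^bsub>ringA\<^esub>) [^]\<^bsub>ringA\<^esub> q \<otimes>\<^bsub>ringA\<^esub> zetaA2 [m + 2 * q]"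
proof -
  let ?ks = "\<lambda>(a, b). replicate a 2 @ [m] @ replicate b 2"
  have bij: "bij_betw (\<lambda>a. (a, q - a)) {..q} {(a, b). a + b = q}"
    by (rule bij_betwI[where g = fst]) auto
  then have fin: "finite {(a, b). a + b = q}"
    using bij_betw_finite by blast
  have "(\<Oplus>\<^bsub>ringA\<^esub> ab\<in>{(a, b). a + b = q}.
           case ab of (a, b) \<Rightarrow> zetaA2 (replicate a 2 @ [m] @ replicate b 2))
      = (\<Oplus>\<^bsub>ringA\<^esub> ab\<in>{(a, b). a + b = q}. reduceA (\<lambda>p. zeta2_int p (?ks ab)))"
    by (simp add: zetaA2_eq case_prod_unfold)
  also have "\<dots> = reduceA (\<lambda>p. \<Sum>ab\<in>{(a, b). a + b = q}. zeta2_int p (?ks ab))"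
    by (rule reduceA_sum[OF fin])
  also have "\<dots> = reduceA (\<lambda>p. \<Sum>a\<le>q. zeta2_int p (replicate a 2 @ [m] @ replicate (q - a) 2))"
    by (simp flip: sum.reindex_bij_betw[OF bij])
  also have "\<dots> = reduceA (\<lambda>p. (- 1) ^ q * zeta2_int p [m + 2 * q])"
    by (rule reduceA_eqI[where N = "4 ^ q"]) (rule sum_zeta2_int_cong)
  also have "\<dots> = (\<ominus>\<^bsub>ringA\<^esub> \<one>\<^bsub>ringA\<^esub>) [^]\<^bsub>ringA\<^esub> q \<otimes>\<^bsub>ringA\<^esub> zetaA2 [m + 2 * q]"
    by (simp add: reduceA_minus_one_power zetaA2_eq reduceA_mult)
  finally show ?thesis .
qed

end
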